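(* Let $\mathbb{B}_0=(X_1,X_2,X_3)$ be the basis of the Lie algebra of $\widetilde{\mathrm{E}_0}(2)$ with $[X_1,X_2]=X_3$, $[X_1,X_3]=-X_2$, $[X_2,X_3]=0$. Let $u>0$, $v>0$ and consider the left invariant metric on $\widetilde{\mathrm{E}_0}(2)$ with matrix in $\mathbb{B}_0$ $$\begin{pmatrix}0&-1&0\\-1&-u&0\\0&0&v\end{pmatrix}.$$ Its Ricci curvature and scalar curvature are $$M(\mathrm{ric},\mathbb{B}_0)=\begin{pmatrix}\frac{v+u}v&\frac{u^2-v^2}{2v}&0\\ \frac{u^2-v^2}{2v}&\frac{u(u^2-v^2)}{2v}&0\\0&0&\frac{u^2-v^2}2\end{pmatrix},\qquad\mathfrak{s}=\frac{(u+v)^2}{2v}.$$ The signature of $\mathrm{ric}$ is $(+,-,-)$ if $u<v$, $(+,+,+)$ if $u>v$, and $(+,0,0)$ if $u=v$.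
   Context: $\widetilde{\mathrm{E}_0}(2)$ is the universal covering group of the connected component of the Euclidean group of the plane. A left invariant metric on a Lie group with Lie algebra $\mathfrak{g}$ is identified with a nondegenerate symmetric bilinear form $\langle\,,\rangle$ on $\mathfrak{g}$. The Levi-Civita product $\mathrm{L}:\mathfrak{g}\times\mathfrak{g}\to\mathfrak{g}$ is given by $2\langle\mathrm{L}_uv,w\rangle=\langle[u,v],w\rangle+\langle[w,u],v\rangle+\langle[w,v],u\rangle$, the curvature by $\mathrm{K}(u,v)=\mathrm{L}_{[u,v]}-[\mathrm{L}_u,\mathrm{L}_v]$, the Ricci tensor by $\mathrm{ric}(u,v)=\mathrm{tr}(w\mapsto\mathrm{K}(u,w)v)$, the Ricci operator by $\langle\mathrm{Ric}(u),v\rangle=\mathrm{ric}(u,v)$, and the scalar curvature by $\mathfrak{s}=\mathrm{tr}(\mathrm{Ric})$. $M(\mathrm{ric},\mathbb{B}_0)$ is the Gram matrix of $\mathrm{ric}$ in $\mathbb{B}_0$. The signature of $\mathrm{ric}$ is its signature as a symmetric bilinear form (signs listed in any order). *)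

theory Defs
  imports "HOL-Analysis.Analysis"
begin

subsection \<open>The Lie algebra of a Lie group structure on a Euclidean space\<close>

text \<open>The group is given by its multiplication \<^term>\<open>m\<close> and its unit \<^term>\<open>e\<close> in one global chart,
  so that the tangent space at \<^term>\<open>e\<close> is the Euclidean space itself. The Lie bracket is the value at
  \<^term>\<open>e\<close> of the commutator \<open>[X, Y] = DY(X) - DX(Y)\<close> of the left invariant vector fields.\<close>

definition left_invariant_field ::
    "('a::euclidean_space \<Rightarrow> 'a \<Rightarrow> 'a) \<Rightarrow> 'a \<Rightarrow> 'a \<Rightarrow> 'a \<Rightarrow> 'a" where
  "left_invariant_field m e x p = frechet_derivative (\<lambda>q. m p q) (at e) x"

definition lie_bracket ::
    "('a::euclidean_space \<Rightarrow> 'a \<Rightarrow> 'a) \<Rightarrow> 'a \<Rightarrow> 'a \<Rightarrow> 'a \<Rightarrow> 'a" where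
  "lie_bracket m e x y =
     frechet_derivative (left_invariant_field m e y) (at e) x -
     frechet_derivative (left_invariant_field m e x) (at e) y"


subsection \<open>The universal covering group of the connected Euclidean group of the plane\<close>

text \<open>The plane is \<open>\<complex>\<close>. The orientation preserving motions, which form the connected component of its
  Euclidean group, are the maps \<open>w \<mapsto> z + cis t * w\<close>. Replacing the rotation \<^term>\<open>cis t\<close> by the angle
  \<open>t \<in> \<real>\<close> yields the simply connected group \<open>\<real> \<times> \<complex>\<close>; the covering map is \<open>motion\<close>.\<close>

type_synonym e2_cover = "real \<times> complex"

definition motion :: "e2_cover \<Rightarrow> complex \<Rightarrow> complex" where
  "motion p w = snd p + cis (fst p) * w"

definition e2_mult :: "e2_cover \<Rightarrow> e2_cover \<Rightarrow> e2_cover" where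
  "e2_mult p q = (fst p + fst q, snd p + cis (fst p) * snd q)"

definition e2_bracket :: "e2_cover \<Rightarrow> e2_cover \<Rightarrow> e2_cover" where
  "e2_bracket = lie_bracket e2_mult 0"

lemma motion_e2_mult: "motion (e2_mult p q) = motion p \<circ> motion q"
  by (rule ext) (simp add: motion_def e2_mult_def cis_mult[symmetric] algebra_simps)

lemma motion_eq_id_iff: "motion p = id \<longleftrightarrow> (\<exists>k::int. p = (2 * pi * of_int k, 0))"
proof
  assume *: "motion p = id"
  have z: "snd p = 0" using fun_cong[OF *, of 0] by (simp add: motion_def)
  have "cis (fst p) = 1" using fun_cong[OF *, of 1] z by (simp add: motion_def)
  then have "cos (fst p) = 1" by (metis cis.sel(1) one_complex.sel(1))
  then obtain k :: int where "fst p = of_int k * 2 * pi" unfolding cos_one_2pi_int by blast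
  then show "\<exists>k::int. p = (2 * pi * of_int k, 0)"
    using z by (intro exI[of _ k]) (simp add: prod_eq_iff algebra_simps)
next
  assume "\<exists>k::int. p = (2 * pi * of_int k, 0)"
  then show "motion p = id" by (auto simp: motion_def fun_eq_iff cis_multiple_2pi)
qed

lemma left_invariant_field_e2: "left_invariant_field e2_mult 0 x p = (fst x, cis (fst p) * snd x)"
proof -
  have "((\<lambda>q. e2_mult p q) has_derivative (\<lambda>x. (fst x, cis (fst p) * snd x))) (at 0)"
    unfolding e2_mult_def by (auto intro!: derivative_eq_intros)
  from frechet_derivative_at[OF this] show ?thesis
    by (simp add: left_invariant_field_def fun_eq_iff)
qed

lemma e2_bracket_eq:
  "e2_bracket x y = (0, \<i> * (of_real (fst x) * snd y - of_real (fst y) * snd x))"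
proof -
  have cis: "((\<lambda>p::e2_cover. cis (fst p)) has_derivative (\<lambda>x. of_real (fst x) * \<i>)) (at 0)"
  proof -
    have "((\<lambda>p::e2_cover. \<i> * of_real (fst p)) has_derivative (\<lambda>x. \<i> * of_real (fst x))) (at 0)"
      by (auto intro!: derivative_eq_intros)
    moreover have "(exp has_derivative ((*) 1)) (at (\<i> * of_real (fst (0::e2_cover))))"
      using DERIV_exp[of "0::complex"] by (simp add: has_field_derivative_def)
    ultimately have "((\<lambda>p::e2_cover. exp (\<i> * of_real (fst p))) has_derivative
        (\<lambda>x. of_real (fst x) * \<i>)) (at 0)"
      using has_derivative_compose by (fastforce simp: mult.commute)
    then show ?thesis by (simp add: cis_conv_exp)
  qed
  have D: "frechet_derivative (left_invariant_field e2_mult 0 y) (at 0) x =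
      (0, of_real (fst x) * \<i> * snd y)" for x y :: e2_cover
  proof -
    have "((\<lambda>p::e2_cover. (fst y, cis (fst p) * snd y)) has_derivative
        (\<lambda>x. (0, of_real (fst x) * \<i> * snd y))) (at 0)"
      using cis by (auto intro!: derivative_eq_intros simp: scaleR_conv_of_real algebra_simps)
    from frechet_derivative_at[OF this, symmetric] show ?thesis
      by (simp add: left_invariant_field_e2[abs_def])
  qed
  show ?thesis
    by (simp add: e2_bracket_def lie_bracket_def D algebra_simps)
qed


subsection \<open>Left invariant metrics and their curvature\<close>

text \<open>In this section \<^term>\<open>br\<close> is the bracket of a Lie algebra and \<^term>\<open>g\<close> a left invariant metric,
  of arbitrary signature, identified with its restriction to the Lie algebra.\<close>

definition symmetric_bilinear :: "('a::real_vector \<Rightarrow> 'a \<Rightarrow> real) \<Rightarrow> bool" where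
  "symmetric_bilinear b \<longleftrightarrow> bilinear b \<and> (\<forall>x y. b x y = b y x)"

definition left_invariant_metric :: "('a::real_vector \<Rightarrow> 'a \<Rightarrow> real) \<Rightarrow> bool" where
  "left_invariant_metric g \<longleftrightarrow> symmetric_bilinear g \<and> (\<forall>x. (\<forall>y. g x y = 0) \<longrightarrow> x = 0)"

text \<open>The inner product of the type \<^typ>\<open>'a\<close> only serves to read off coordinates here; the trace does
  not depend on it.\<close>

definition lin_trace :: "('a::euclidean_space \<Rightarrow> 'a) \<Rightarrow> real" where
  "lin_trace f = (\<Sum>b\<in>Basis. f b \<bullet> b)"

definition levi_civita ::
    "('a::euclidean_space \<Rightarrow> 'a \<Rightarrow> 'a) \<Rightarrow> ('a \<Rightarrow> 'a \<Rightarrow> real) \<Rightarrow> 'a \<Rightarrow> 'a \<Rightarrow> 'a" where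
  "levi_civita br g u v =
     (THE x. \<forall>w. 2 * g x w = g (br u v) w + g (br w u) v + g (br w v) u)"

definition curvature ::
    "('a::euclidean_space \<Rightarrow> 'a \<Rightarrow> 'a) \<Rightarrow> ('a \<Rightarrow> 'a \<Rightarrow> real) \<Rightarrow> 'a \<Rightarrow> 'a \<Rightarrow> 'a \<Rightarrow> 'a" where
  "curvature br g u v w =
     levi_civita br g (br u v) w -
     (levi_civita br g u (levi_civita br g v w) - levi_civita br g v (levi_civita br g u w))"

definition ricci ::
    "('a::euclidean_space \<Rightarrow> 'a \<Rightarrow> 'a) \<Rightarrow> ('a \<Rightarrow> 'a \<Rightarrow> real) \<Rightarrow> 'a \<Rightarrow> 'a \<Rightarrow> real" where
  "ricci br g u v = lin_trace (\<lambda>w. curvature br g u w v)"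

definition ricci_operator ::
    "('a::euclidean_space \<Rightarrow> 'a \<Rightarrow> 'a) \<Rightarrow> ('a \<Rightarrow> 'a \<Rightarrow> real) \<Rightarrow> 'a \<Rightarrow> 'a" where
  "ricci_operator br g u = (THE x. \<forall>v. g x v = ricci br g u v)"

definition scalar_curvature ::
    "('a::euclidean_space \<Rightarrow> 'a \<Rightarrow> 'a) \<Rightarrow> ('a \<Rightarrow> 'a \<Rightarrow> real) \<Rightarrow> real" where
  "scalar_curvature br g = lin_trace (ricci_operator br g)"


subsection \<open>Bases, Gram matrices, signatures\<close>

definition is_basis :: "'a::real_vector ^ 'n \<Rightarrow> bool" where
  "is_basis B \<longleftrightarrow>
     inj (\<lambda>i. B $ i) \<and> independent (range (\<lambda>i. B $ i)) \<and> span (range (\<lambda>i. B $ i)) = UNIV"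

definition gram_matrix :: "('a \<Rightarrow> 'a \<Rightarrow> real) \<Rightarrow> 'a ^ 'n \<Rightarrow> real ^ 'n ^ 'n" where
  "gram_matrix b B = (\<chi> i j. b (B $ i) (B $ j))"

text \<open>\<open>has_signature b p n z\<close>: the form \<^term>\<open>b\<close> has \<^term>\<open>p\<close> signs \<open>+\<close>, \<^term>\<open>n\<close> signs \<open>-\<close> and
  \<^term>\<open>z\<close> zeros on the diagonal of its matrix in some orthogonal basis. By Sylvester's law of inertia these
  numbers are the same for all orthogonal bases.\<close>

definition has_signature ::
    "('a::euclidean_space \<Rightarrow> 'a \<Rightarrow> real) \<Rightarrow> nat \<Rightarrow> nat \<Rightarrow> nat \<Rightarrow> bool" where
  "has_signature b p n z \<longleftrightarrow> symmetric_bilinear b \<and>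
     (\<exists>E. independent E \<and> span E = UNIV \<and> (\<forall>x\<in>E. \<forall>y\<in>E. x \<noteq> y \<longrightarrow> b x y = 0) \<and>
        card {x\<in>E. b x x > 0} = p \<and> card {x\<in>E. b x x < 0} = n \<and> card {x\<in>E. b x x = 0} = z)"

text \<open>The basis \<open>(1, 0), (0, 1), (0, \<i>)\<close> satisfies \<open>[X\<^sub>1, X\<^sub>2] = X\<^sub>3\<close>, \<open>[X\<^sub>1, X\<^sub>3] = - X\<^sub>2\<close>,
  \<open>[X\<^sub>2, X\<^sub>3] = 0\<close>.\<close>

lemma e2_standard_basis:
  defines "B \<equiv> vector [(1, 0), (0, 1), (0, \<i>)] :: e2_cover ^ 3"
  shows "is_basis B"
    and "e2_bracket (B $ 1) (B $ 2) = B $ 3"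
    and "e2_bracket (B $ 1) (B $ 3) = - (B $ 2)"
    and "e2_bracket (B $ 2) (B $ 3) = 0"
proof -
  have R: "range (\<lambda>i. B $ i) = Basis"
    by (auto simp: B_def UNIV_3 Basis_prod_def Basis_complex_def)
  have "inj (\<lambda>i. B $ i)"
    by (auto simp: inj_def forall_3 B_def)
  then show "is_basis B"
    unfolding is_basis_def R by (simp add: independent_Basis span_Basis)
  show "e2_bracket (B $ 1) (B $ 2) = B $ 3" "e2_bracket (B $ 1) (B $ 3) = - (B $ 2)"
    "e2_bracket (B $ 2) (B $ 3) = 0"
    by (simp_all add: B_def e2_bracket_eq zero_prod_def)
qed

end

theory Submission
  imports Defs
begin

text \<open>The metric itself provides the coordinates with respect to the given frame. In these
  coordinates the Koszul formula is solved explicitly, and the Ricci tensor is a polynomial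
  computation. The basis \<open>X\<^sub>1\<close>, \<open>X\<^sub>2 - (u - v)/2 X\<^sub>1\<close>, \<open>X\<^sub>3\<close> diagonalises the Ricci tensor, for every
  \<open>u\<close> and \<open>v\<close>, with diagonal entries \<open>(u + v)/v\<close>, \<open>(u + v)(u\<^sup>2 - v\<^sup>2)/(4 v)\<close>, \<open>(u\<^sup>2 - v\<^sup>2)/2\<close>; the
  first is positive and the other two have the sign of \<open>u - v\<close>.\<close>

section \<open>Traces and signatures in an arbitrary basis\<close>

lemma lin_trace_eq_sum_coordinates:
  fixes B :: "'a::euclidean_space ^ 'n" and c :: "'n \<Rightarrow> 'a \<Rightarrow> real"
  assumes f: "linear f" and c: "\<And>i. linear (c i)" and x: "\<And>x. (\<Sum>i\<in>UNIV. c i x *\<^sub>R B $ i) = x"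
  shows "lin_trace f = (\<Sum>i\<in>UNIV. c i (f (B $ i)))"
proof -
  have lin: "linear (\<lambda>x. c i (f x))" for i
    using linear_compose[OF f c] by (simp add: o_def)
  have "lin_trace f = (\<Sum>b\<in>Basis. (\<Sum>i\<in>UNIV. c i (f b) *\<^sub>R B $ i) \<bullet> b)"
    by (simp add: lin_trace_def x)
  also have "\<dots> = (\<Sum>i\<in>UNIV. \<Sum>b\<in>Basis. (B $ i \<bullet> b) * c i (f b))"
    by (subst sum.swap) (simp add: inner_sum_left mult.commute)
  \<comment> \<open>The inner products left by expanding each \<open>f b\<close> along the family
    \<open>B\<close> are the coordinates of \<open>B $ i\<close> in \<open>Basis\<close>. Linearity
    of \<open>c i\<close> after \<open>f\<close> lets them reassemble \<open>B $ i\<close>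
    inside.\<close>
  also have "\<dots> = (\<Sum>i\<in>UNIV. c i (f (\<Sum>b\<in>Basis. (B $ i \<bullet> b) *\<^sub>R b)))"
    by (simp add: linear_sum[OF lin] linear_scale[OF lin])
  finally show ?thesis
    by (simp add: euclidean_representation)
qed

text \<open>Since the family spans, the dimension is at most the number of distinct members, which
  is at most the number of indices. The two ends agree, so no member is repeated and the spanning
  set has minimal size.\<close>

lemma is_basisI_span:
  fixes B :: "'a::euclidean_space ^ 'n"
  assumes span: "span (range (\<lambda>i. B $ i)) = UNIV" and dim: "DIM('a) = CARD('n)"
  shows "is_basis B"
proof -
  let ?R = "range (\<lambda>i. B $ i)"
  have "dim ?R = CARD('n)"
    using span dim by (metis dim_UNIV dim_span)
  moreover have "dim ?R \<le> card ?R" "card ?R \<le> CARD('n)"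
    by (simp_all add: dim_le_card' card_image_le)
  ultimately have card: "card ?R = CARD('n)"
    by linarith
  then have "inj (\<lambda>i. B $ i)"
    by (simp add: eq_card_imp_inj_on)
  moreover have "independent ?R"
    using card dim span by (intro card_le_dim_spanning[of _ UNIV]) auto
  ultimately show ?thesis
    using span by (simp add: is_basis_def)
qed

text \<open>Injectivity of the family turns the counts over the set of basis vectors in
  \<open>has_signature\<close> into counts over indices.\<close>

lemma has_signatureI_basis:
  fixes E :: "'a::euclidean_space ^ 'n"
  assumes b: "symmetric_bilinear b" and E: "is_basis E"
    and orth: "\<And>i j. i \<noteq> j \<Longrightarrow> b (E $ i) (E $ j) = 0"
  shows "has_signature b (card {i. b (E $ i) (E $ i) > 0})
    (card {i. b (E $ i) (E $ i) < 0}) (card {i. b (E $ i) (E $ i) = 0})"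
proof -
  let ?R = "range (\<lambda>i. E $ i)"
  have inj: "inj (\<lambda>i. E $ i)" and R: "independent ?R" "span ?R = UNIV"
    using E by (auto simp: is_basis_def)
  have card: "card {x \<in> ?R. P x} = card {i. P (E $ i)}" for P
  proof -
    have "{x \<in> ?R. P x} = (\<lambda>i. E $ i) ` {i. P (E $ i)}"
      by auto
    then show ?thesis
      using inj by (simp add: card_image inj_on_subset)
  qed
  show ?thesis
    unfolding has_signature_def
    using b R card by (intro conjI exI[of _ ?R]) (auto intro: orth)
qed

section \<open>Uniqueness from nondegeneracy of the metric\<close>

lemma metric_eqI:
  assumes "left_invariant_metric g" and "\<And>w. g x w = g y w"
  shows "x = y"
proof -
  have "bilinear g"
    using assms(1) by (simp add: left_invariant_metric_def symmetric_bilinear_def)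
  then have "g (x - y) w = 0" for w
    using assms(2) by (simp add: bilinear_lsub)
  then show ?thesis
    using assms(1) by (metis left_invariant_metric_def right_minus_eq)
qed

text \<open>Nondegeneracy makes the solution of the Koszul formula unique, so the description in
  \<open>levi_civita\<close> is settled by exhibiting one solution.\<close>

lemma levi_civita_eqI:
  assumes "left_invariant_metric g"
    and "\<And>w. 2 * g x w = g (br a b) w + g (br w a) b + g (br w b) a"
  shows "levi_civita br g a b = x"
  unfolding levi_civita_def
proof (rule the_equality)
  fix y assume y: "\<forall>w. 2 * g y w = g (br a b) w + g (br w a) b + g (br w b) a"
  show "y = x"
  proof (rule metric_eqI[OF assms(1)])
    show "g y w = g x w" for w
      using y[rule_format, of w] assms(2)[of w] by linarith
  qed
qed (use assms(2) in blast)

lemma ricci_operator_eqI: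
  assumes "left_invariant_metric g" and "\<And>w. g x w = ricci br g a w"
  shows "ricci_operator br g a = x"
  unfolding ricci_operator_def
proof (rule the_equality)
  fix y assume "\<forall>w. g y w = ricci br g a w"
  then show "y = x"
    using assms by (intro metric_eqI[OF assms(1)]) simp
qed (use assms(2) in blast)

section \<open>Coordinates in the given frame\<close>

locale e2_metric_frame =
  fixes B :: "e2_cover ^ 3" and g :: "e2_cover \<Rightarrow> e2_cover \<Rightarrow> real" and u v :: real
  assumes basis: "is_basis B"
    and bracket12: "e2_bracket (B $ 1) (B $ 2) = B $ 3"
    and bracket13: "e2_bracket (B $ 1) (B $ 3) = - (B $ 2)"
    and bracket23: "e2_bracket (B $ 2) (B $ 3) = 0"
    and u_pos: "u > 0" and v_pos: "v > 0"
    and metric: "left_invariant_metric g"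
    and gram: "gram_matrix g B =
      vector [vector [ 0, -1, 0],
              vector [-1, -u, 0],
              vector [ 0,  0, v]]"
begin

definition comb :: "real \<Rightarrow> real \<Rightarrow> real \<Rightarrow> e2_cover" where
  "comb a b c = a *\<^sub>R B $ 1 + b *\<^sub>R B $ 2 + c *\<^sub>R B $ 3"

text \<open>This applies the inverse of the Gram matrix to the pairings with the frame: for
  \<open>x = comb a b c\<close> these pairings are \<open>-b\<close>, \<open>-a - u * b\<close> and
  \<open>v * c\<close>. Linearity in \<open>x\<close> is then inherited from
  \<open>g\<close>.\<close>

definition coord :: "3 \<Rightarrow> e2_cover \<Rightarrow> real" where
  "coord i x = (if i = 1 then u * g x (B $ 1) - g x (B $ 2)
    else if i = 2 then - g x (B $ 1) else g x (B $ 3) / v)"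

lemma bilinear_g: "bilinear g"
  using metric by (simp add: left_invariant_metric_def symmetric_bilinear_def)

lemmas g_simps = bilinear_ladd[OF bilinear_g] bilinear_radd[OF bilinear_g]
  bilinear_lmul[OF bilinear_g] bilinear_rmul[OF bilinear_g]

lemma g_frame:
  "g (B $ 1) (B $ 1) = 0" "g (B $ 1) (B $ 2) = -1" "g (B $ 1) (B $ 3) = 0"
  "g (B $ 2) (B $ 1) = -1" "g (B $ 2) (B $ 2) = -u" "g (B $ 2) (B $ 3) = 0"
  "g (B $ 3) (B $ 1) = 0" "g (B $ 3) (B $ 2) = 0" "g (B $ 3) (B $ 3) = v"
  using gram by (simp_all add: gram_matrix_def vec_eq_iff forall_3)

lemma g_comb: "g (comb a b c) (comb p q r) = - a * q - b * p - u * b * q + v * c * r"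
  by (simp add: comb_def g_simps g_frame algebra_simps)

lemma comb_add: "comb a b c + comb p q r = comb (a + p) (b + q) (c + r)"
  and comb_diff: "comb a b c - comb p q r = comb (a - p) (b - q) (c - r)"
  and comb_scale: "k *\<^sub>R comb a b c = comb (k * a) (k * b) (k * c)"
  by (simp_all add: comb_def algebra_simps)

lemma frame_eq_comb: "B $ 1 = comb 1 0 0" "B $ 2 = comb 0 1 0" "B $ 3 = comb 0 0 1"
  by (simp_all add: comb_def)

lemma coord_comb [simp]:
  "coord 1 (comb a b c) = a" "coord 2 (comb a b c) = b" "coord 3 (comb a b c) = c"
  using v_pos by (simp_all add: coord_def frame_eq_comb g_comb)

lemma comb_eq_iff: "comb a b c = comb p q r \<longleftrightarrow> a = p \<and> b = q \<and> c = r"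
  by (metis coord_comb)

lemma linear_coord: "linear (coord i)"
  by (rule linearI) (simp_all add: coord_def g_simps algebra_simps add_divide_distrib)

lemmas coord_linear = linear_add[OF linear_coord] linear_scale[OF linear_coord]

text \<open>Both sides are linear in \<open>x\<close> and agree on the frame, which spans the Lie
  algebra.\<close>

lemma sum_coord: "(\<Sum>i\<in>UNIV. coord i x *\<^sub>R B $ i) = x"
proof (rule linear_eq_on_span[where g = id and B = "range (\<lambda>i. B $ i)", unfolded id_apply])
  show "linear (\<lambda>x. \<Sum>i\<in>UNIV. coord i x *\<^sub>R B $ i)"
    by (rule linearI) (simp_all add: coord_linear scaleR_add_left sum.distrib scaleR_sum_right)
  show "linear (\<lambda>x::e2_cover. x)"
    by (rule linear_ident)
  have "(\<Sum>i\<in>UNIV. coord i (B $ j) *\<^sub>R B $ i) = B $ j" for j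
    using exhaust_3[of j] by (auto simp: sum_3 frame_eq_comb comb_scale comb_add)
  then show "(\<Sum>i\<in>UNIV. coord i y *\<^sub>R B $ i) = y" if "y \<in> range (\<lambda>i. B $ i)" for y
    using that by auto
  show "x \<in> span (range (\<lambda>i. B $ i))"
    using basis by (simp add: is_basis_def)
qed

lemma comb_coord: "comb (coord 1 x) (coord 2 x) (coord 3 x) = x"
  using sum_coord[of x] by (simp add: sum_3 comb_def)

lemma comb_cases: obtains a b c where "x = comb a b c"
  using comb_coord by metis

text \<open>The explicit formula for \<open>e2_bracket\<close> supplies only bilinearity and skew
  symmetry. The structure constants come from the assumed relations, so the frame may differ from
  the standard one.\<close>

lemma bracket_comb: "e2_bracket (comb a b c) (comb p q r) = comb 0 (c * p - a * r) (a * q - b * p)"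
proof -
  have add: "e2_bracket (x + y) z = e2_bracket x z + e2_bracket y z"
    "e2_bracket z (x + y) = e2_bracket z x + e2_bracket z y" for x y z
    by (simp_all add: e2_bracket_eq algebra_simps)
  have scale: "e2_bracket (k *\<^sub>R x) y = k *\<^sub>R e2_bracket x y"
    "e2_bracket x (k *\<^sub>R y) = k *\<^sub>R e2_bracket x y" for k x y
    by (simp_all add: e2_bracket_eq scaleR_conv_of_real algebra_simps)
  have skew: "e2_bracket x y = - e2_bracket y x" for x y
    by (simp add: e2_bracket_eq algebra_simps)
  have self: "e2_bracket x x = 0" for x
    by (simp add: e2_bracket_eq zero_prod_def)
  have flip: "e2_bracket (B $ 2) (B $ 1) = - B $ 3" "e2_bracket (B $ 3) (B $ 1) = B $ 2"
    "e2_bracket (B $ 3) (B $ 2) = 0"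
    using bracket12 bracket13 bracket23 skew[of "B $ 2" "B $ 1"] skew[of "B $ 3" "B $ 1"]
      skew[of "B $ 3" "B $ 2"] by simp_all
  show ?thesis
    by (simp add: comb_def add scale self flip bracket12 bracket13 bracket23 algebra_simps)
qed

section \<open>Levi-Civita product, Ricci tensor and scalar curvature\<close>

lemma levi_civita_comb:
  "levi_civita e2_bracket g (comb a b c) (comb p q r) =
    comb ((u * (2 * a * r + (u + v) * (b * r + c * q)) - u * (a * r - c * p) + v * (a * r + c * p)) / 2)
        (- (2 * a * r + (u + v) * (b * r + c * q)) / 2)
        ((v * (a * q - b * p) - 2 * a * p - u * (a * q + b * p)) / (2 * v))"
proof (rule levi_civita_eqI[OF metric])
  \<comment> \<open>The coordinates arise by solving the Koszul formula for particular
    \<open>w\<close>: \<open>B $ 1\<close> gives the second coordinate, \<open>B $ 2\<close> then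
    gives the first, and \<open>B $ 3\<close> gives the third. Here the solution is checked against
    every \<open>w\<close>.\<close>
  fix w
  obtain x y z where "w = comb x y z"
    by (rule comb_cases)
  then show "2 * g (comb ((u * (2 * a * r + (u + v) * (b * r + c * q)) - u * (a * r - c * p) +
        v * (a * r + c * p)) / 2) (- (2 * a * r + (u + v) * (b * r + c * q)) / 2)
        ((v * (a * q - b * p) - 2 * a * p - u * (a * q + b * p)) / (2 * v))) w =
      g (e2_bracket (comb a b c) (comb p q r)) w + g (e2_bracket w (comb a b c)) (comb p q r) +
      g (e2_bracket w (comb p q r)) (comb a b c)"
    using v_pos by (simp add: bracket_comb g_comb field_simps)
qed

text \<open>Bilinearity is read off from the coordinate formula. It makes the curvature linear in
  the argument over which the Ricci trace is taken, so that this trace can be computed in the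
  frame.\<close>

lemma bilinear_levi_civita: "bilinear (levi_civita e2_bracket g)"
proof -
  note simps = comb_add comb_scale levi_civita_comb comb_eq_iff
  have "levi_civita e2_bracket g (x + y) z =
      levi_civita e2_bracket g x z + levi_civita e2_bracket g y z" for x y z
    using v_pos by (cases x rule: comb_cases; cases y rule: comb_cases; cases z rule: comb_cases)
      (simp add: simps field_simps)
  moreover have "levi_civita e2_bracket g z (x + y) =
      levi_civita e2_bracket g z x + levi_civita e2_bracket g z y" for x y z
    using v_pos by (cases x rule: comb_cases; cases y rule: comb_cases; cases z rule: comb_cases)
      (simp add: simps field_simps)
  moreover have "levi_civita e2_bracket g (k *\<^sub>R x) z = k *\<^sub>R levi_civita e2_bracket g x z" for k x z
    using v_pos by (cases x rule: comb_cases; cases z rule: comb_cases)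
      (simp add: simps field_simps)
  moreover have "levi_civita e2_bracket g z (k *\<^sub>R x) = k *\<^sub>R levi_civita e2_bracket g z x" for k x z
    using v_pos by (cases x rule: comb_cases; cases z rule: comb_cases)
      (simp add: simps field_simps)
  ultimately show ?thesis
    by (auto simp: bilinear_def intro!: linearI)
qed

lemma linear_curvature: "linear (\<lambda>w. curvature e2_bracket g x w y)"
proof -
  note L = bilinear_ladd[OF bilinear_levi_civita] bilinear_radd[OF bilinear_levi_civita]
    bilinear_lmul[OF bilinear_levi_civita] bilinear_rmul[OF bilinear_levi_civita]
  have "e2_bracket x (w + w') = e2_bracket x w + e2_bracket x w'"
    "e2_bracket x (k *\<^sub>R w) = k *\<^sub>R e2_bracket x w" for k w w'
    by (simp_all add: e2_bracket_eq scaleR_conv_of_real algebra_simps)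
  then show ?thesis
    by (intro linearI) (simp_all add: curvature_def L algebra_simps)
qed

lemma lin_trace_frame:
  "linear f \<Longrightarrow> lin_trace f =
    coord 1 (f (comb 1 0 0)) + coord 2 (f (comb 0 1 0)) + coord 3 (f (comb 0 0 1))"
  by (simp add: lin_trace_eq_sum_coordinates[OF _ linear_coord sum_coord] sum_3 frame_eq_comb)

lemma ricci_comb:
  "ricci e2_bracket g (comb a b c) (comb p q r) =
    (v + u) / v * (a * p) + (u\<^sup>2 - v\<^sup>2) / (2 * v) * (a * q + b * p) +
    u * (u\<^sup>2 - v\<^sup>2) / (2 * v) * (b * q) + (u\<^sup>2 - v\<^sup>2) / 2 * (c * r)"
  unfolding ricci_def lin_trace_frame[OF linear_curvature]
  using v_pos
  by (simp add: curvature_def bracket_comb levi_civita_comb comb_diff)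
     (simp add: divide_simps, simp add: algebra_simps power2_eq_square)

lemma symmetric_bilinear_ricci: "symmetric_bilinear (ricci e2_bracket g)"
proof -
  have sym: "ricci e2_bracket g x y = ricci e2_bracket g y x" for x y
    by (cases x rule: comb_cases; cases y rule: comb_cases) (simp add: ricci_comb algebra_simps)
  have "ricci e2_bracket g x (y + z) = ricci e2_bracket g x y + ricci e2_bracket g x z" for x y z
    by (cases x rule: comb_cases; cases y rule: comb_cases; cases z rule: comb_cases)
      (simp add: comb_add ricci_comb distrib_left add_divide_distrib)
  moreover have "ricci e2_bracket g x (k *\<^sub>R y) = k *\<^sub>R ricci e2_bracket g x y" for k x y
    by (cases x rule: comb_cases; cases y rule: comb_cases)
      (simp add: comb_scale ricci_comb algebra_simps)
  ultimately have "linear (ricci e2_bracket g x)" for x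
    by (simp add: linearI)
  moreover have "(\<lambda>x. ricci e2_bracket g x y) = ricci e2_bracket g y" for y
    using sym by blast
  ultimately show ?thesis
    using sym unfolding symmetric_bilinear_def bilinear_def by simp
qed

text \<open>Raising an index with the metric: the coefficient of \<open>x\<close> in the Ricci form
  determines the second coordinate, and the coefficient of \<open>y\<close> then determines the
  first, where the terms in \<open>b\<close> cancel.\<close>

lemma ricci_operator_comb:
  "ricci_operator e2_bracket g (comb a b c) =
    comb ((u + v)\<^sup>2 / (2 * v) * a)
        (- (v + u) / v * a - (u\<^sup>2 - v\<^sup>2) / (2 * v) * b)
        ((u\<^sup>2 - v\<^sup>2) / (2 * v) * c)"
proof (rule ricci_operator_eqI[OF metric])
  fix w
  obtain x y z where "w = comb x y z"
    by (rule comb_cases)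
  then show "g (comb ((u + v)\<^sup>2 / (2 * v) * a) (- (v + u) / v * a - (u\<^sup>2 - v\<^sup>2) / (2 * v) * b)
      ((u\<^sup>2 - v\<^sup>2) / (2 * v) * c)) w = ricci e2_bracket g (comb a b c) w"
    using v_pos by (simp add: g_comb ricci_comb field_simps power2_eq_square)
qed

lemma scalar_curvature_eq: "scalar_curvature e2_bracket g = (u + v)\<^sup>2 / (2 * v)"
proof -
  have "ricci_operator e2_bracket g (x + y) =
      ricci_operator e2_bracket g x + ricci_operator e2_bracket g y" for x y
    by (cases x rule: comb_cases; cases y rule: comb_cases)
      (simp add: comb_add ricci_operator_comb comb_eq_iff distrib_left)
  moreover have "ricci_operator e2_bracket g (k *\<^sub>R x) = k *\<^sub>R ricci_operator e2_bracket g x"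
    for k x
    by (cases x rule: comb_cases)
      (simp add: comb_scale ricci_operator_comb comb_eq_iff algebra_simps)
  ultimately have "linear (ricci_operator e2_bracket g)"
    by (simp add: linearI)
  \<comment> \<open>The second and third diagonal entries of the operator in the frame are opposite,
    so the first entry is the whole trace.\<close>
  then show ?thesis
    by (simp add: scalar_curvature_def lin_trace_frame ricci_operator_comb)
qed

lemma gram_matrix_ricci:
  "gram_matrix (ricci e2_bracket g) B =
      vector [vector [(v + u) / v, (u\<^sup>2 - v\<^sup>2) / (2 * v), 0],
              vector [(u\<^sup>2 - v\<^sup>2) / (2 * v), u * (u\<^sup>2 - v\<^sup>2) / (2 * v), 0],
              vector [0, 0, (u\<^sup>2 - v\<^sup>2) / 2]]"
  by (simp add: gram_matrix_def vec_eq_iff forall_3 frame_eq_comb ricci_comb)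

section \<open>Signature of the Ricci tensor\<close>

lemma signature_ricci:
  "(u < v \<longrightarrow> has_signature (ricci e2_bracket g) 1 2 0) \<and>
   (u > v \<longrightarrow> has_signature (ricci e2_bracket g) 3 0 0) \<and>
   (u = v \<longrightarrow> has_signature (ricci e2_bracket g) 1 0 2)"
proof -
  \<comment> \<open>Gram-Schmidt for the Ricci form: the coefficient \<open>t = (v - u) / 2\<close>
    solves \<open>(v + u) / v * t + (u^2 - v^2) / (2 * v) = 0\<close>, which makes the second vector
    orthogonal to the first.\<close>
  define E :: "e2_cover ^ 3" where "E = vector [comb 1 0 0, comb ((v - u) / 2) 1 0, comb 0 0 1]"
  have E: "E $ 1 = comb 1 0 0" "E $ 2 = comb ((v - u) / 2) 1 0" "E $ 3 = comb 0 0 1"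
    by (simp_all add: E_def)
  have "x \<in> span (range (\<lambda>i. E $ i))" for x
  proof -
    obtain a b c where "x = comb a b c"
      by (rule comb_cases)
    then have "x = (a - b * (v - u) / 2) *\<^sub>R E $ 1 + b *\<^sub>R E $ 2 + c *\<^sub>R E $ 3"
      by (simp add: E comb_add comb_scale)
    then show ?thesis
      by (simp add: span_add span_scale span_base)
  qed
  then have basis_E: "is_basis E"
    by (intro is_basisI_span) auto
  \<comment> \<open>The last two entries are written as a positive factor times
    \<open>u - v\<close>, so that their signs can be read off uniformly.\<close>
  have diag: "ricci e2_bracket g (E $ 1) (E $ 1) = (u + v) / v"
    "ricci e2_bracket g (E $ 2) (E $ 2) = (u + v)\<^sup>2 / (4 * v) * (u - v)"
    "ricci e2_bracket g (E $ 3) (E $ 3) = (u + v) / 2 * (u - v)"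
    using v_pos by (simp_all add: E ricci_comb field_simps power2_eq_square)
  have "ricci e2_bracket g (E $ i) (E $ j) = 0" if "i \<noteq> j" for i j
    using exhaust_3[of i] exhaust_3[of j] that v_pos
    by (auto simp: E ricci_comb field_simps power2_eq_square)
  note sig = has_signatureI_basis[OF symmetric_bilinear_ricci basis_E this]
  have pos: "(u + v) / v > 0" "(u + v)\<^sup>2 / (4 * v) > 0" "(u + v) / 2 > 0"
    using u_pos v_pos by simp_all
  define d where "d i = ricci e2_bracket g (E $ i) (E $ i)" for i
  have d1: "d 1 > 0" and d: "sgn (d 2) = sgn (u - v)" "sgn (d 3) = sgn (u - v)"
    unfolding d_def diag sgn_mult using pos by (simp_all only: sgn_pos mult_1)
  \<comment> \<open>Counting index by index reduces each of the three numbers in the signature to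
    the signs of \<open>d 1\<close>, \<open>d 2\<close> and \<open>d 3\<close>.\<close>
  have card: "card {i. P (d i)} = of_bool (P (d 1)) + of_bool (P (d 2)) + of_bool (P (d 3))"
    for P
  proof -
    have "card {i. P (d i)} = (\<Sum>i\<in>UNIV. of_bool (P (d i)))"
      by (simp add: of_bool_def sum.If_cases)
    then show ?thesis
      by (simp add: sum_3)
  qed
  have "has_signature (ricci e2_bracket g)
      (card {i. 0 < d i}) (card {i. d i < 0}) (card {i. d i = 0})"
    using sig by (simp add: d_def)
  then show ?thesis
    unfolding card[of "\<lambda>x. 0 < x"] card[of "\<lambda>x. x < 0"] card[of "\<lambda>x. x = 0"]
    using d1 d by (auto simp: sgn_if eval_nat_numeral split: if_splits)
qed

end

theorem proposition4p18:
  fixes B :: "e2_cover ^ 3" and g :: "e2_cover \<Rightarrow> e2_cover \<Rightarrow> real" and u v :: real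
  assumes "is_basis B"
    and "e2_bracket (B $ 1) (B $ 2) = B $ 3"
    and "e2_bracket (B $ 1) (B $ 3) = - (B $ 2)"
    and "e2_bracket (B $ 2) (B $ 3) = 0"
    and "u > 0" and "v > 0"
    and "left_invariant_metric g"
    and "gram_matrix g B =
      vector [vector [ 0, -1, 0],
              vector [-1, -u, 0],
              vector [ 0,  0, v]]"
  shows "gram_matrix (ricci e2_bracket g) B =
      vector [vector [(v + u) / v, (u\<^sup>2 - v\<^sup>2) / (2 * v), 0],
              vector [(u\<^sup>2 - v\<^sup>2) / (2 * v), u * (u\<^sup>2 - v\<^sup>2) / (2 * v), 0],
              vector [0, 0, (u\<^sup>2 - v\<^sup>2) / 2]] \<and>
    scalar_curvature e2_bracket g = (u + v)\<^sup>2 / (2 * v) \<and>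
    (u < v \<longrightarrow> has_signature (ricci e2_bracket g) 1 2 0) \<and>
    (u > v \<longrightarrow> has_signature (ricci e2_bracket g) 3 0 0) \<and>
    (u = v \<longrightarrow> has_signature (ricci e2_bracket g) 1 0 2)"
proof -
  interpret e2_metric_frame B g u v
    using assms by unfold_locales
  show ?thesis
    using gram_matrix_ricci scalar_curvature_eq signature_ricci by blast
qed

end
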